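(* Let $\varphi\in\Phi$ satisfy $\sup_{y\in[1/c,\,c]}\varphi(y)<+\infty$ for every $c>1$. Let $v,w:G\to(0,+\infty)$ be the weights $v(x+iy)=e^{-\varphi(y)}$ and $w(x+iy)=e^{-\varphi^{**}(y)}$. Then $$\bigl(H_v(G),\|\cdot\|_v\bigr)\equiv\bigl(H_w(G),\|\cdot\|_w\bigr),$$ that is, $H_v(G)$ and $H_w(G)$ are the same set of functions and $\|f\|_v=\|f\|_w$ for every $f$ in it.
   Context: $G=\{x+iy : x\in\mathbb{R},\ y\in(0,+\infty)\}\subset\mathbb{C}$ is the open upper half plane. $\Phi$ is the set of all functions $\varphi:(0,+\infty)\to\mathbb{R}$ (no continuity assumed) for which there exists a real number $a$ with $\inf_{x\in(0,+\infty)}(\varphi(x)-ax)>-\infty$. For $\varphi\in\Phi$ let $M_\varphi=\{(a,b)\in\mathbb{R}^2 : \inf_{t\in(0,+\infty)}(\varphi(t)-at)>b\}$, and define $\varphi^{**}:(0,+\infty)\to\mathbb{R}$ by $\varphi^{**}(x)=\sup_{(a,b)\in M_\varphi}(ax+b)$. For a weight $u:G\to(0,+\infty)$, $H_u(G)$ is the space of all holomorphic functions $f$ on $G$ with $\|f\|_u:=\sup_{z\in G}u(z)|f(z)|<+\infty$. *)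

theory Defs
  imports "HOL-Complex_Analysis.Complex_Analysis"
begin

text \<open>
  Functions on $(0,+\infty)$ and on $G$ are represented by total functions on the reals and on
  the complex numbers; every notion below looks only at their values on $(0,+\infty)$ and on $G$.
  Infima and suprema that may be infinite are taken in the extended reals.
\<close>

definition upper_half_plane :: "complex set" where
  "upper_half_plane = {z. Im z > 0}"

definition Phi :: "(real \<Rightarrow> real) set" where
  "Phi = {\<phi>. \<exists>a::real. (INF x\<in>{0<..}. ereal (\<phi> x - a * x)) > -\<infinity>}"

definition minorants :: "(real \<Rightarrow> real) \<Rightarrow> (real \<times> real) set" where
  "minorants \<phi> = {(a, b). (INF t\<in>{0<..}. ereal (\<phi> t - a * t)) > ereal b}"

text \<open>
  The supremum in the next definition is a real one; the two lemmas after it show that for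
  $\varphi \in \Phi$ and $x > 0$ it is taken over a nonempty set that is bounded above.
\<close>

definition biconjugate :: "(real \<Rightarrow> real) \<Rightarrow> real \<Rightarrow> real" where
  "biconjugate \<phi> x = (SUP (a, b)\<in>minorants \<phi>. a * x + b)"

lemma minorants_nonempty:
  assumes "\<phi> \<in> Phi"
  shows "minorants \<phi> \<noteq> {}"
proof -
  obtain a :: real where "(INF x\<in>{0<..}. ereal (\<phi> x - a * x)) > -\<infinity>"
    using assms unfolding Phi_def by blast
  then obtain b :: real where "ereal b < (INF x\<in>{0<..}. ereal (\<phi> x - a * x))"
    using ereal_dense2 by blast
  then show ?thesis
    unfolding minorants_def by blast
qed

lemma bdd_above_minorants:
  assumes "x > 0"
  shows "bdd_above ((\<lambda>(a, b). a * x + b) ` minorants \<phi>)"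
proof (rule bdd_aboveI2[where M = "\<phi> x"], clarify)
  fix a b assume "(a, b) \<in> minorants \<phi>"
  then have "ereal b < (INF t\<in>{0<..}. ereal (\<phi> t - a * t))"
    by (simp add: minorants_def)
  also have "\<dots> \<le> ereal (\<phi> x - a * x)"
    using assms by (intro INF_lower) simp
  finally show "a * x + b \<le> \<phi> x"
    by simp
qed

definition weighted_norm :: "(complex \<Rightarrow> real) \<Rightarrow> (complex \<Rightarrow> complex) \<Rightarrow> ereal" where
  "weighted_norm u f = (SUP z\<in>upper_half_plane. ereal (u z * cmod (f z)))"

definition H_space :: "(complex \<Rightarrow> real) \<Rightarrow> (complex \<Rightarrow> complex) set" where
  "H_space u = {f. f holomorphic_on upper_half_plane \<and> weighted_norm u f < \<infinity>}"

end

theory Submission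
  imports Defs
begin

text \<open>
  A function in either space is bounded on every closed strip inside the half plane, so by the
  three lines theorem the logarithm of its supremum over the line $\mathrm{Im}\, z = y$ is a convex
  function of $y$. If $|f| \le C e^{\varphi}$, this convex function lies below $\varphi + \ln C$;
  its supporting lines are then affine minorants of $\varphi + \ln C$, hence it lies below
  $\varphi^{**} + \ln C$.
\<close>

section \<open>Three lines theorem on a horizontal strip\<close>

text \<open>This is the three lines theorem with the geometric interpolation between the edges
  written as the exponential of an affine function of \<open>Im z\<close>. The proof is a
  Phragmen-Lindelof argument; the bound \<open>M\<close> only decides how wide a rectangle is taken
  and is absent from the result.\<close>

lemma strip_affine_bound:
  fixes f :: "complex \<Rightarrow> complex" and a b \<alpha> \<beta> M :: real
  assumes hol: "f holomorphic_on {z. a < Im z \<and> Im z < b}"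
    and cont: "continuous_on {z. a \<le> Im z \<and> Im z \<le> b} f"
    and bounded: "\<And>z. a \<le> Im z \<Longrightarrow> Im z \<le> b \<Longrightarrow> cmod (f z) \<le> M"
    and edges: "\<And>z. Im z = a \<or> Im z = b \<Longrightarrow> cmod (f z) \<le> exp (\<alpha> + \<beta> * Im z)"
    and z0: "a < Im z0" "Im z0 < b"
  shows "cmod (f z0) \<le> exp (\<alpha> + \<beta> * Im z0)"
proof -
  define K where "K = max \<bar>a\<bar> \<bar>b\<bar>"
  have M: "M \<ge> 0"
    using bounded[of z0] z0 norm_ge_zero[of "f z0"] by linarith
  \<comment> \<open>\<open>K\<close> bounds the modulus of \<open>Im z\<close> on the strip. The
    damping costs at most \<open>\<epsilon> * K\<^sup>2\<close> in the exponent, and undoing it at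
    \<open>z0\<close> gives the rest of the error, which is linear in
    \<open>\<epsilon>\<close>.\<close>
  have damped: "cmod (f z0) \<le> exp (\<alpha> + \<beta> * Im z0 + \<epsilon> * (K\<^sup>2 + (Re z0)\<^sup>2 - (Im z0)\<^sup>2))"
    if \<epsilon>: "\<epsilon> > 0" for \<epsilon>
  proof -
    \<comment> \<open>\<open>L\<close> dominates \<open>M - \<alpha> - \<beta> * Im z\<close> on the
      strip. \<open>R\<close> is large enough that \<open>z0\<close> lies in the rectangle and that,
      on its vertical sides, the damping \<open>\<epsilon> * R\<^sup>2\<close> outweighs
      \<open>L\<close>.\<close>
    define L where "L = M + \<bar>\<alpha>\<bar> + \<bar>\<beta>\<bar> * K"
    define R where "R = 1 + \<bar>Re z0\<bar> + L / \<epsilon>"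
    have L: "L \<ge> 0" using M by (simp add: L_def K_def)
    then have R: "R \<ge> 1" "R > \<bar>Re z0\<bar>" using \<epsilon> by (simp_all add: R_def add.commute add_pos_nonneg)
    have "L \<le> \<epsilon> * R"
      using \<epsilon> by (simp add: R_def field_simps)
    also have "\<dots> \<le> \<epsilon> * R\<^sup>2"
      using \<epsilon> R by (simp add: power2_eq_square)
    finally have LR: "L \<le> \<epsilon> * R\<^sup>2" .
    \<comment> \<open>The linear term normalises both edges to 1; the Gaussian damping makes the vertical sides of a
      wide rectangle harmless.\<close>
    define g where
      "g z = f z * exp (of_real (-\<alpha>) + \<i> * of_real \<beta> * z - of_real \<epsilon> * z\<^sup>2)" for z
    have norm_g: "cmod (g z) = cmod (f z) * exp (- \<alpha> - \<beta> * Im z - \<epsilon> * ((Re z)\<^sup>2 - (Im z)\<^sup>2))" for z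
      by (simp add: g_def norm_mult Re_power2)
    define S where "S = cbox (Complex (-R) a) (Complex R b)"
    have "cmod (g z0) \<le> exp (\<epsilon> * K\<^sup>2)"
    proof (rule maximum_modulus_frontier[of g S])
      have "interior S \<subseteq> {z. a < Im z \<and> Im z < b}"
        by (auto simp: S_def in_box_complex_iff)
      then show "g holomorphic_on interior S"
        unfolding g_def by (intro holomorphic_intros holomorphic_on_subset[OF hol])
      have "closure S \<subseteq> {z. a \<le> Im z \<and> Im z \<le> b}"
        by (auto simp: S_def in_cbox_complex_iff)
      then show "continuous_on (closure S) g"
        unfolding g_def by (intro continuous_intros continuous_on_subset[OF cont])
      show "bounded S" by (simp add: S_def bounded_cbox)
      show "z0 \<in> S" using z0 R by (auto simp: S_def in_cbox_complex_iff)
    next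
      fix z assume "z \<in> frontier S"
      then have z: "\<bar>Re z\<bar> \<le> R" "a \<le> Im z" "Im z \<le> b"
        and edge: "Im z = a \<or> Im z = b \<or> \<bar>Re z\<bar> = R"
        by (auto simp: S_def frontier_cbox in_cbox_complex_iff in_box_complex_iff)
      have absK: "\<bar>Im z\<bar> \<le> K" using z by (auto simp: K_def)
      then have K2: "(Im z)\<^sup>2 \<le> K\<^sup>2" using abs_le_square_iff[of "Im z" K] by simp
      have "\<epsilon> * (Im z)\<^sup>2 \<le> \<epsilon> * K\<^sup>2" "0 \<le> \<epsilon> * (Re z)\<^sup>2"
        using \<epsilon> K2 by simp_all
      note eK = this
      show "cmod (g z) \<le> exp (\<epsilon> * K\<^sup>2)"
      proof (cases "\<bar>Re z\<bar> = R")
        case False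
        then have "cmod (f z) \<le> exp (\<alpha> + \<beta> * Im z)" using edge edges by blast
        then have "cmod (g z) \<le> exp (\<alpha> + \<beta> * Im z) * exp (- \<alpha> - \<beta> * Im z - \<epsilon> * ((Re z)\<^sup>2 - (Im z)\<^sup>2))"
          unfolding norm_g by (intro mult_right_mono) auto
        also have "\<dots> \<le> exp (\<epsilon> * K\<^sup>2)"
          using eK by (simp add: exp_add[symmetric] algebra_simps)
        finally show ?thesis .
      next
        case True
        then have RR: "(Re z)\<^sup>2 = R\<^sup>2" by (metis power2_abs)
        \<comment> \<open>Passing from \<open>M\<close> to \<open>exp M\<close> puts all factors
          into a single exponent, also when \<open>M\<close> is 0 and is no exponential
          itself.\<close>
        have "M \<le> exp M" using exp_ge_add_one_self[of M] by linarith
        then have "cmod (f z) \<le> exp M" using bounded[OF z(2,3)] by linarith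
        then have "cmod (g z) \<le> exp M * exp (- \<alpha> - \<beta> * Im z - \<epsilon> * ((Re z)\<^sup>2 - (Im z)\<^sup>2))"
          unfolding norm_g by (intro mult_right_mono) auto
        also have "\<dots> = exp (M - \<alpha> - \<beta> * Im z - \<epsilon> * R\<^sup>2 + \<epsilon> * (Im z)\<^sup>2)"
          by (simp add: RR exp_add[symmetric] algebra_simps)
        also have "\<dots> \<le> exp (\<epsilon> * K\<^sup>2)"
        proof -
          have "\<bar>\<beta> * Im z\<bar> \<le> \<bar>\<beta>\<bar> * K"
            unfolding abs_mult using absK by (intro mult_left_mono) auto
          then have "M - \<alpha> - \<beta> * Im z \<le> L" unfolding L_def by linarith
          then show ?thesis using LR eK by simp
        qed
        finally show ?thesis .
      qed
    qed
    then have "cmod (f z0) \<le> exp (\<epsilon> * K\<^sup>2) / exp (- \<alpha> - \<beta> * Im z0 - \<epsilon> * ((Re z0)\<^sup>2 - (Im z0)\<^sup>2))"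
      unfolding norm_g by (simp add: pos_le_divide_eq)
    also have "\<dots> = exp (\<alpha> + \<beta> * Im z0 + \<epsilon> * (K\<^sup>2 + (Re z0)\<^sup>2 - (Im z0)\<^sup>2))"
      by (simp add: exp_diff[symmetric] algebra_simps)
    finally show ?thesis .
  qed
  \<comment> \<open>The point \<open>z0\<close> is fixed while \<open>\<epsilon>\<close> decreases
    to 0, so the error in the exponent disappears in the limit.\<close>
  have "((\<lambda>\<epsilon>. exp (\<alpha> + \<beta> * Im z0 + \<epsilon> * (K\<^sup>2 + (Re z0)\<^sup>2 - (Im z0)\<^sup>2)))
          \<longlongrightarrow> exp (\<alpha> + \<beta> * Im z0 + 0 * (K\<^sup>2 + (Re z0)\<^sup>2 - (Im z0)\<^sup>2))) (at_right 0)"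
    by (intro tendsto_intros)
  then show ?thesis
    using damped by (intro tendsto_lowerbound[where F = "at_right 0"])
      (auto simp: eventually_at_right_less eventually_at_filter)
qed

section \<open>Logarithmic convexity of the suprema over horizontal lines\<close>

text \<open>By the identity theorem, a function that vanishes on a horizontal line, whose points
  accumulate in the half plane, vanishes everywhere. Strict positivity has to be known before
  logarithms are taken, because \<open>ln 0\<close> is 0 here and not minus infinity.\<close>

lemma horizontal_sup_pos:
  fixes f :: "complex \<Rightarrow> complex"
  assumes hol: "f holomorphic_on upper_half_plane"
    and nz: "\<xi> \<in> upper_half_plane" "f \<xi> \<noteq> 0"
    and y: "y > 0"
    and bdd: "bdd_above (range (\<lambda>x. cmod (f (Complex x y))))"
  shows "(SUP x. cmod (f (Complex x y))) > 0"
proof -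
  have uhp: "open upper_half_plane" "connected upper_half_plane"
    unfolding upper_half_plane_def
    by (auto intro: open_halfspace_Im_gt convex_connected convex_halfspace_Im_gt)
  have "\<exists>x. f (Complex x y) \<noteq> 0"
  proof (rule ccontr)
    assume zero: "\<nexists>x. f (Complex x y) \<noteq> 0"
    have "f \<xi> = 0"
    proof (rule analytic_continuation[OF hol uhp, of "range (\<lambda>x. Complex x y)" "Complex 0 y"])
      show "Complex 0 y islimpt range (\<lambda>x. Complex x y)"
        unfolding islimpt_approachable
      proof (intro allI impI)
        fix e :: real assume "e > 0"
        then show "\<exists>x'\<in>range (\<lambda>x. Complex x y). x' \<noteq> Complex 0 y \<and> dist x' (Complex 0 y) < e"
          by (intro bexI[of _ "Complex (e/2) y"]) (auto simp: dist_norm cmod_def)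
      qed
    qed (use zero y nz in \<open>auto simp: upper_half_plane_def\<close>)
    then show False using nz by simp
  qed
  then obtain x where "f (Complex x y) \<noteq> 0" by blast
  then have "0 < cmod (f (Complex x y))" by simp
  also have "\<dots> \<le> (SUP x. cmod (f (Complex x y)))"
    by (rule cSUP_upper[OF _ bdd]) simp
  finally show ?thesis .
qed

text \<open>The chord of the logarithm between two heights is the affine exponent of
  \<open>strip_affine_bound\<close>. The assumption \<open>strips\<close> gives both the finiteness
  of the suprema and the boundedness which that lemma requires.\<close>

lemma ln_horizontal_sup_convex:
  fixes f :: "complex \<Rightarrow> complex"
  assumes hol: "f holomorphic_on upper_half_plane"
    and nz: "\<xi> \<in> upper_half_plane" "f \<xi> \<noteq> 0"
    and strips: "\<And>a b. 0 < a \<Longrightarrow> a < b \<Longrightarrow> \<exists>M. \<forall>z. a \<le> Im z \<longrightarrow> Im z \<le> b \<longrightarrow> cmod (f z) \<le> M"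
  shows "convex_on {0<..} (\<lambda>y. ln (SUP x. cmod (f (Complex x y))))"
proof -
  define h where "h y = (SUP x. cmod (f (Complex x y)))" for y
  have bdd: "bdd_above (range (\<lambda>x. cmod (f (Complex x y))))" if y: "y > 0" for y
  proof -
    \<comment> \<open>\<open>strips\<close> speaks of strips of positive width, so the line at
      height \<open>y\<close> is taken as the lower edge of one.\<close>
    have "y < y + 1" by simp
    from strips[OF y this] obtain M where "\<forall>z. y \<le> Im z \<longrightarrow> Im z \<le> y + 1 \<longrightarrow> cmod (f z) \<le> M"
      by blast
    then show ?thesis by (intro bdd_aboveI2[where M = M]) simp
  qed
  have pos: "h y > 0" if "y > 0" for y
    unfolding h_def using horizontal_sup_pos[OF hol nz that bdd[OF that]] .
  have le_h: "cmod (f z) \<le> h (Im z)" if "Im z > 0" for z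
    using cSUP_upper[OF UNIV_I bdd[OF that], of "Re z"] by (simp add: h_def)
  have "convex_on {0<..} (\<lambda>y. ln (h y))"
  proof (rule convex_on_linorderI)
    fix t a b :: real
    assume t: "0 < t" "t < 1" and "a \<in> {0<..}" "b \<in> {0<..}" and ab: "a < b"
    then have a: "a > 0" and b: "b > 0" by auto
    \<comment> \<open>Slope and intercept of the chord of \<open>ln (h y)\<close> through the
      heights \<open>a\<close> and \<open>b\<close>; thus
      \<open>exp (\<alpha> + \<beta> * y)\<close> equals \<open>h y\<close> at both.\<close>
    define \<beta> where "\<beta> = (ln (h b) - ln (h a)) / (b - a)"
    define \<alpha> where "\<alpha> = ln (h a) - \<beta> * a"
    have \<beta>: "\<beta> * (b - a) = ln (h b) - ln (h a)" using ab by (simp add: \<beta>_def)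
    have at_a: "\<alpha> + \<beta> * a = ln (h a)" by (simp add: \<alpha>_def)
    have at_b: "\<alpha> + \<beta> * b = ln (h b)" using \<beta> by (simp add: \<alpha>_def algebra_simps)
    define y where "y = (1 - t) * a + t * b"
    have "y - a = t * (b - a)" "b - y = (1 - t) * (b - a)" by (simp_all add: y_def algebra_simps)
    then have y: "a < y" "y < b" using t ab by (metis diff_gt_0_iff_gt mult_pos_pos)+
    obtain M where M: "\<forall>z. a \<le> Im z \<longrightarrow> Im z \<le> b \<longrightarrow> cmod (f z) \<le> M"
      using strips a ab by blast
    have "cmod (f (Complex x y)) \<le> exp (\<alpha> + \<beta> * y)" for x
    proof -
      have "cmod (f (Complex x y)) \<le> exp (\<alpha> + \<beta> * Im (Complex x y))"
      proof (rule strip_affine_bound)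
        show "f holomorphic_on {z. a < Im z \<and> Im z < b}"
          by (rule holomorphic_on_subset[OF hol]) (use a in \<open>auto simp: upper_half_plane_def\<close>)
        show "continuous_on {z. a \<le> Im z \<and> Im z \<le> b} f"
          by (rule continuous_on_subset[OF holomorphic_on_imp_continuous_on[OF hol]])
            (use a in \<open>auto simp: upper_half_plane_def\<close>)
        show "cmod (f z) \<le> M" if "a \<le> Im z" "Im z \<le> b" for z using M that by blast
        show "cmod (f z) \<le> exp (\<alpha> + \<beta> * Im z)" if "Im z = a \<or> Im z = b" for z
        proof -
          have z: "Im z > 0" using that a b by auto
          have "\<alpha> + \<beta> * Im z = ln (h (Im z))" using that at_a at_b by auto
          then show ?thesis using le_h[OF z] pos[OF z] by simp
        qed
      qed (use y in auto)
      then show ?thesis by simp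
    qed
    then have "h y \<le> exp (\<alpha> + \<beta> * y)" unfolding h_def by (intro cSUP_least) auto
    then have "ln (h y) \<le> ln (exp (\<alpha> + \<beta> * y))"
      using pos[OF order.strict_trans[OF a y(1)]] by (intro ln_mono) auto
    then have "ln (h y) \<le> \<alpha> + \<beta> * y" by simp
    also have "\<dots> = (1 - t) * (\<alpha> + \<beta> * a) + t * (\<alpha> + \<beta> * b)"
      by (simp add: y_def algebra_simps)
    finally show "ln (h ((1 - t) *\<^sub>R a + t *\<^sub>R b)) \<le> (1 - t) * ln (h a) + t * ln (h b)"
      unfolding at_a at_b y_def by simp
  qed simp
  then show ?thesis unfolding h_def .
qed

section \<open>Affine minorants and the biconjugate\<close>

lemma biconjugate_le:
  assumes "\<phi> \<in> Phi" "x > 0"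
  shows "biconjugate \<phi> x \<le> \<phi> x"
  unfolding biconjugate_def
proof (rule cSUP_least[OF minorants_nonempty[OF assms(1)]], clarify)
  fix a b assume "(a, b) \<in> minorants \<phi>"
  then have "ereal b < (INF t\<in>{0<..}. ereal (\<phi> t - a * t))"
    by (simp add: minorants_def)
  also have "\<dots> \<le> ereal (\<phi> x - a * x)"
    using assms by (intro INF_lower) simp
  finally show "a * x + b \<le> \<phi> x" by simp
qed

text \<open>\<open>minorants\<close> demands strict inequality against the infimum, so a line
  touching the graph need not belong to it. Lowering the line by any \<open>e > 0\<close> makes it a
  member, and \<open>e\<close> is arbitrary.\<close>

lemma affine_minorant_le_biconjugate:
  assumes minorant: "\<And>t. t > 0 \<Longrightarrow> a * t + b \<le> \<phi> t" and x: "x > 0"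
  shows "a * x + b \<le> biconjugate \<phi> x"
proof (rule field_le_epsilon)
  fix e :: real assume e: "e > 0"
  have "ereal (b - e) < ereal b" using e by simp
  also have "\<dots> \<le> (INF t\<in>{0<..}. ereal (\<phi> t - a * t))"
    using minorant by (intro INF_greatest) (auto simp: le_diff_eq add.commute)
  finally have "(a, b - e) \<in> minorants \<phi>" by (simp add: minorants_def)
  from cSUP_upper[OF this bdd_above_minorants[OF x]]
  show "a * x + b \<le> biconjugate \<phi> x + e" by (simp add: biconjugate_def)
qed

text \<open>A supporting line of \<open>g\<close> at \<open>x\<close>, lowered by \<open>c\<close>,
  is an affine minorant of \<open>\<phi>\<close>, and at \<open>x\<close> it takes the value
  \<open>g x - c\<close>.\<close>

lemma convex_le_biconjugate:
  assumes conv: "convex_on {0<..} g" and le: "\<And>t. t > 0 \<Longrightarrow> g t \<le> \<phi> t + c" and x: "x > 0"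
  shows "g x \<le> biconjugate \<phi> x + c"
proof -
  \<comment> \<open>The infimum of the difference quotients to the right of \<open>x\<close> is the
    right derivative of \<open>g\<close> at \<open>x\<close>, hence the slope of a supporting
    line.\<close>
  define s where "s = Inf ((\<lambda>t. (g x - g t) / (x - t)) ` ({x<..} \<inter> {0<..}))"
  have tangent: "g x + s * (t - x) \<le> g t" if "t > 0" for t
    unfolding s_def using convex_le_Inf_differential[OF conv, of x t] that x
    by (simp add: interior_open)
  have "s * x + (g x - s * x - c) \<le> biconjugate \<phi> x"
  proof (rule affine_minorant_le_biconjugate[OF _ x])
    fix t :: real assume "t > 0"
    then show "s * t + (g x - s * x - c) \<le> \<phi> t"
      using tangent[of t] le[of t] by (simp add: algebra_simps)
  qed
  then show ?thesis by simp
qed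

section \<open>Growth bounds and equality of the weighted norms\<close>

lemma weighted_norm_le_iff:
  "weighted_norm u f \<le> ereal C \<longleftrightarrow> (\<forall>z. Im z > 0 \<longrightarrow> u z * cmod (f z) \<le> C)"
  by (auto simp: weighted_norm_def SUP_le_iff upper_half_plane_def)

lemma bounded_on_strips:
  fixes \<phi> :: "real \<Rightarrow> real"
  assumes sup: "\<And>c::real. c > 1 \<Longrightarrow> (SUP y\<in>{1/c..c}. ereal (\<phi> y)) < \<infinity>"
    and C: "C \<ge> 0"
    and f: "\<And>z. Im z > 0 \<Longrightarrow> cmod (f z) \<le> C * exp (\<phi> (Im z))"
    and ab: "0 < a" "a < b"
  shows "\<exists>M. \<forall>z. a \<le> Im z \<longrightarrow> Im z \<le> b \<longrightarrow> cmod (f z) \<le> M"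
proof -
  \<comment> \<open>This choice gives \<open>c > 1\<close> and places \<open>{a..b}\<close> inside
    \<open>{1/c..c}\<close>, where \<open>\<phi>\<close> is bounded above.\<close>
  define c where "c = 1 + 1 / a + b"
  have c: "c > 1" "c \<ge> b" "1 / a \<le> c" using ab by (simp_all add: c_def add_pos_pos)
  then have ca: "1 / c \<le> a" using ab by (simp add: field_simps)
  obtain m where m: "(SUP y\<in>{1/c..c}. ereal (\<phi> y)) < ereal m"
    using sup[OF c(1)] ereal_dense2 by blast
  have "cmod (f z) \<le> C * exp m" if z: "a \<le> Im z" "Im z \<le> b" for z
  proof -
    have "ereal (\<phi> (Im z)) \<le> (SUP y\<in>{1/c..c}. ereal (\<phi> y))"
      using z c ca by (intro SUP_upper) auto
    with m have "\<phi> (Im z) \<le> m" by (metis ereal_less_eq(3) less_imp_le order.trans)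
    then have "C * exp (\<phi> (Im z)) \<le> C * exp m" using C by (intro mult_left_mono) auto
    then show ?thesis using f[of z] z ab by linarith
  qed
  then show ?thesis by blast
qed

text \<open>This is the analytic half of the norm equality: the bound by \<open>\<phi>\<close>
  improves to one by the biconjugate with the same constant \<open>C\<close>, since
  \<open>ln C\<close> enters only as an additive shift of the convex function.\<close>

lemma biconjugate_growth_bound:
  fixes \<phi> :: "real \<Rightarrow> real"
  assumes sup: "\<And>c::real. c > 1 \<Longrightarrow> (SUP y\<in>{1/c..c}. ereal (\<phi> y)) < \<infinity>"
    and hol: "f holomorphic_on upper_half_plane"
    and f: "\<And>z. Im z > 0 \<Longrightarrow> cmod (f z) \<le> C * exp (\<phi> (Im z))"
    and z: "Im z > 0"
  shows "cmod (f z) \<le> C * exp (biconjugate \<phi> (Im z))"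
proof -
  have C0: "C \<ge> 0"
    using order.trans[OF norm_ge_zero f[OF z]] by (simp add: zero_le_mult_iff)
  \<comment> \<open>At a zero of \<open>f\<close> the bound is trivial. At any other point
    \<open>z\<close>, that point itself witnesses that \<open>f\<close> is not identically zero, and
    it forces \<open>C > 0\<close>, so the logarithms of \<open>h\<close> and of \<open>C\<close>
    can be used.\<close>
  show ?thesis
  proof (cases "f z = 0")
    case True
    then show ?thesis using C0 by simp
  next
    case nz: False
    then have C: "C > 0" using f[OF z] C0 by (cases "C = 0") auto
    define h where "h y = (SUP x. cmod (f (Complex x y)))" for y
    have zU: "z \<in> upper_half_plane" using z by (simp add: upper_half_plane_def)
    have fy: "cmod (f (Complex x y)) \<le> C * exp (\<phi> y)" if "y > 0" for x y
      using f[of "Complex x y"] that by simp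
    have bdd: "bdd_above (range (\<lambda>x. cmod (f (Complex x y))))" if "y > 0" for y
      using fy[OF that] by (rule bdd_aboveI2)
    have pos: "h y > 0" if "y > 0" for y
      unfolding h_def using horizontal_sup_pos[OF hol zU nz that bdd[OF that]] .
    have "ln (h (Im z)) \<le> biconjugate \<phi> (Im z) + ln C"
    proof (rule convex_le_biconjugate[OF _ _ z])
      show "convex_on {0<..} (\<lambda>y. ln (h y))"
        unfolding h_def
        by (rule ln_horizontal_sup_convex[OF hol zU nz bounded_on_strips[OF sup C0 f]])
      fix y :: real assume y: "y > 0"
      have "h y \<le> C * exp (\<phi> y)" unfolding h_def using fy[OF y] by (intro cSUP_least) auto
      then have "ln (h y) \<le> ln (C * exp (\<phi> y))" using pos[OF y] C by (intro ln_mono) auto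
      then show "ln (h y) \<le> \<phi> y + ln C" using C by (simp add: ln_mult)
    qed
    then have "exp (ln (h (Im z))) \<le> exp (biconjugate \<phi> (Im z) + ln C)" by simp
    then have "h (Im z) \<le> C * exp (biconjugate \<phi> (Im z))"
      using pos[OF z] C by (simp add: exp_add mult.commute)
    moreover have "cmod (f z) \<le> h (Im z)"
      using cSUP_upper[OF UNIV_I bdd[OF z], of "Re z"] by (simp add: h_def)
    ultimately show ?thesis by simp
  qed
qed

lemma exp_minus_mult_le_iff: "exp (- r) * t \<le> C \<longleftrightarrow> t \<le> C * exp r" for r t C :: real
  by (simp add: exp_minus field_simps)

theorem theorem6p1:
  fixes \<phi> :: "real \<Rightarrow> real" and v w :: "complex \<Rightarrow> real"
  assumes "\<phi> \<in> Phi"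
    and "\<And>c::real. c > 1 \<Longrightarrow> (SUP y\<in>{1/c..c}. ereal (\<phi> y)) < \<infinity>"
    and "\<And>x y::real. y > 0 \<Longrightarrow> v (Complex x y) = exp (- \<phi> y)"
    and "\<And>x y::real. y > 0 \<Longrightarrow> w (Complex x y) = exp (- biconjugate \<phi> y)"
  shows "H_space v = H_space w \<and> (\<forall>f\<in>H_space v. weighted_norm v f = weighted_norm w f)"
proof -
  have v: "v z = exp (- \<phi> (Im z))" if "Im z > 0" for z
    using assms(3)[OF that, of "Re z"] by simp
  have w: "w z = exp (- biconjugate \<phi> (Im z))" if "Im z > 0" for z
    using assms(4)[OF that, of "Re z"] by simp
  \<comment> \<open>The equality is proved in the extended reals for every holomorphic
    \<open>f\<close>, including those of infinite norm; this is what also makes the two spaces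
    coincide as sets.\<close>
  have norm_eq: "weighted_norm v f = weighted_norm w f" if hol: "f holomorphic_on upper_half_plane" for f
  proof (rule antisym)
    show "weighted_norm v f \<le> weighted_norm w f"
      unfolding weighted_norm_def
    proof (rule SUP_subset_mono[OF subset_refl])
      fix z assume "z \<in> upper_half_plane"
      then have z: "Im z > 0" by (simp add: upper_half_plane_def)
      then show "ereal (v z * cmod (f z)) \<le> ereal (w z * cmod (f z))"
        using biconjugate_le[OF assms(1) z] unfolding v[OF z] w[OF z] ereal_less_eq(3)
        by (intro mult_right_mono) simp_all
    qed
    show "weighted_norm w f \<le> weighted_norm v f"
    \<comment> \<open>It suffices to transfer every real upper bound \<open>C\<close> of the first
      norm to the second; an infinite first norm has no such bound and leaves nothing to
      check.\<close>
    proof (rule ereal_le_real)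
      fix C assume le: "weighted_norm v f \<le> ereal C"
      have v_bound: "cmod (f z) \<le> C * exp (\<phi> (Im z))" if z: "Im z > 0" for z
      proof -
        have "v z * cmod (f z) \<le> C" using le z unfolding weighted_norm_le_iff by blast
        then show ?thesis unfolding v[OF z] exp_minus_mult_le_iff .
      qed
      show "weighted_norm w f \<le> ereal C"
        unfolding weighted_norm_le_iff
      proof (intro allI impI)
        fix z assume z: "Im z > 0"
        show "w z * cmod (f z) \<le> C"
          unfolding w[OF z] exp_minus_mult_le_iff
          by (rule biconjugate_growth_bound[OF assms(2) hol v_bound z])
      qed
    qed
  qed
  have "f \<in> H_space v \<longleftrightarrow> f \<in> H_space w" for f
    unfolding H_space_def mem_Collect_eq using norm_eq by metis
  moreover have "weighted_norm v f = weighted_norm w f" if "f \<in> H_space v" for f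
    using that by (intro norm_eq) (simp add: H_space_def)
  ultimately show ?thesis by blast
qed

end
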